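(* Let $A,C>0$, let $U$ be an axially symmetric potential as in the context, and let $L\ge0$. Data $(\mathbf R_0,\mathbf P_0,\mathbf G_0,N)$ with $\frac{\partial U}{\partial\mathbf R}(\mathbf R_0)\neq\mathbf 0$ define a locally central relative equilibrium with total angular momentum of modulus $L$ and satisfying $A\widetilde\Omega_3=C\Omega_3$ (an inclined co-planar precession), where $\Omega_3$ is the third component of $\mathbf I^{-1}\mathbf G_0$ and $\widetilde\Omega_3=\Omega_3+N$, if and only if $$\frac{L^2}{(R_0^2+A)^2}\,\mathbf R_0=\frac{\partial U}{\partial\mathbf R}(\mathbf R_0),\quad \langle\mathbf G_0,\mathbf R_0\rangle=0,\quad \|\mathbf G_0\|=\frac{A\,L}{R_0^2+A},\quad \mathbf P_0=\frac1A\mathbf G_0\times\mathbf R_0,\quad N=\frac{C-A}{A}\Omega_3,$$ where $R_0=\|\mathbf R_0\|$. In cylindrical coordinates the first of these equations reads $$\rho\frac{L^2}{(R_3^2+\rho^2+A)^2}=U_\rho,\qquad R_3\frac{L^2}{(R_3^2+\rho^2+A)^2}=U_3 .$$ In particular, let $\mathbf R_0=[R_1,0,R_3]^T$ with $R_1R_3\ne0$ be a solution of this equation with $\frac{\partial U}{\partial\mathbf R}(\mathbf R_0)\neq\mathbf 0$. Then the admissible vectors $\mathbf G_0$ are exactly $$\mathbf G_0=a_1A[0,1,0]^T+a_2\frac{A}{R_0}[R_3,0,-R_1]^T,\qquad a_1,a_2\in\mathbb R,\quad a_1^2+a_2^2=\frac{L^2}{(R_0^2+A)^2},$$ so that each such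 $\mathbf R_0$ gives a one-parameter family of relative equilibria; for these, with $\mathbf Z=[0,0,1]^T$ and $\widetilde{\boldsymbol\Omega}=\mathbf I^{-1}\mathbf G_0+[0,0,N]^T$, $$\langle\mathbf R_0,\mathbf Z\rangle=R_3,\qquad \langle\mathbf P_0,\mathbf Z\rangle=-a_1R_1,\qquad \langle\mathbf R_0\times(\widetilde{\boldsymbol\Omega}\times\mathbf R_0),\mathbf Z\rangle=-a_2R_0R_1 .$$
   Context: Let $A,C>0$ and $\mathbf I=\operatorname{diag}(A,A,C)$. Let $D\subset\mathbb R^3\setminus\{\mathbf 0\}$ be an open set invariant under all rotations about the third coordinate axis, and let $U:D\to\mathbb R$ be a smooth function satisfying the axial symmetry condition $R_1\frac{\partial U}{\partial R_2}-R_2\frac{\partial U}{\partial R_1}=0$ on $D$. The (body-frame) equations of motion of a point mass and an axially symmetric rigid body are $$\dot{\mathbf R}=\mathbf R\times\boldsymbol\Omega+\mathbf P,\quad \dot{\mathbf P}=\mathbf P\times\boldsymbol\Omega-\frac{\partial U}{\partial\mathbf R},\quad \dot{\mathbf G}=\mathbf G\times\boldsymbol\Omega+\mathbf R\times\frac{\partial U}{\partial\mathbf R},\qquad \boldsymbol\Omega=\mathbf I^{-1}\mathbf G,$$ for $(\mathbf R,\mathbf P,\mathbf G)\in D\times\mathbb R^3\times\mathbb R^3$. Let $\mathbf A_3(\varphi)$ denote the matrix of rotation by angle $\varphi$ about the third axis, $\mathbf A_3(\varphi)=\begin{bmatrix}\cos\varphi&-\sin\varphi&0\\ \sin\varphi&\cos\varphi&0\\0&0&1\end{bmatrix}$.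 A relative equilibrium with data $(\mathbf R_0,\mathbf P_0,\mathbf G_0,N)$, where $\mathbf R_0\in D$, $\mathbf P_0,\mathbf G_0\in\mathbb R^3$ are constant vectors and $N\in\mathbb R$, is a solution of these equations of the form $\mathbf R(t)=\mathbf A_3(Nt)\mathbf R_0$, $\mathbf P(t)=\mathbf A_3(Nt)\mathbf P_0$, $\mathbf G(t)=\mathbf A_3(Nt)\mathbf G_0$. It is called locally central if $\mathbf R_0\times\frac{\partial U}{\partial\mathbf R}(\mathbf R_0)=\mathbf 0$. Its total angular momentum (body frame) is $\mathbf L=\mathbf R\times\mathbf P+\mathbf G$, whose modulus $L=\|\mathbf R_0\times\mathbf P_0+\mathbf G_0\|$ is constant. In cylindrical coordinates, with $\rho=\sqrt{R_1^2+R_2^2}$, $U$ depends only on $(\rho,R_3)$ and is written $U(\rho,R_3)$, meaning $U$ evaluated at $(\rho,0,R_3)$; $U_\rho=\partial U/\partial\rho$ and $U_3=\partial U/\partial R_3$. *)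

theory Defs
  imports "HOL-Analysis.Analysis"
begin

text \<open>\<open>Ck_on\<close> is meant for open sets \<open>S\<close>: there the derivatives below depend only on the
  values of \<open>f\<close> on \<open>S\<close>.\<close>

primrec Ck_on :: "nat \<Rightarrow> 'a::euclidean_space set \<Rightarrow> ('a \<Rightarrow> real) \<Rightarrow> bool" where
  "Ck_on 0 S f \<longleftrightarrow> continuous_on S f"
| "Ck_on (Suc k) S f \<longleftrightarrow>
     f differentiable_on S \<and> (\<forall>b\<in>Basis. Ck_on k S (\<lambda>x. frechet_derivative f (at x) b))"

definition smooth_on :: "'a::euclidean_space set \<Rightarrow> ('a \<Rightarrow> real) \<Rightarrow> bool" where
  "smooth_on S f \<longleftrightarrow> (\<forall>k. Ck_on k S f)"

definition grad :: "(real^3 \<Rightarrow> real) \<Rightarrow> real^3 \<Rightarrow> real^3" where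
  "grad U x = (\<chi> i. frechet_derivative U (at x) (axis i 1))"

definition rot3 :: "real \<Rightarrow> real^3^3" where
  "rot3 \<phi> = vector [vector [cos \<phi>, - sin \<phi>, 0], vector [sin \<phi>, cos \<phi>, 0], vector [0, 0, 1]]"

definition inertia :: "real \<Rightarrow> real \<Rightarrow> real^3^3" where
  "inertia A C = vector [vector [A, 0, 0], vector [0, A, 0], vector [0, 0, C]]"

definition Omega :: "real \<Rightarrow> real \<Rightarrow> real^3 \<Rightarrow> real^3" where
  "Omega A C G = matrix_inv (inertia A C) *v G"

definition Omega_tilde :: "real \<Rightarrow> real \<Rightarrow> real^3 \<Rightarrow> real \<Rightarrow> real^3" where
  "Omega_tilde A C G N = Omega A C G + vector [0, 0, N]"

definition solves_eom ::
  "real \<Rightarrow> real \<Rightarrow> (real^3) set \<Rightarrow> (real^3 \<Rightarrow> real) \<Rightarrow>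
   (real \<Rightarrow> real^3) \<Rightarrow> (real \<Rightarrow> real^3) \<Rightarrow> (real \<Rightarrow> real^3) \<Rightarrow> bool" where
  "solves_eom A C D U R P G \<longleftrightarrow> (\<forall>t. R t \<in> D \<and>
     (R has_vector_derivative cross3 (R t) (Omega A C (G t)) + P t) (at t) \<and>
     (P has_vector_derivative cross3 (P t) (Omega A C (G t)) - grad U (R t)) (at t) \<and>
     (G has_vector_derivative
        cross3 (G t) (Omega A C (G t)) + cross3 (R t) (grad U (R t))) (at t))"

definition relative_equilibrium ::
  "real \<Rightarrow> real \<Rightarrow> (real^3) set \<Rightarrow> (real^3 \<Rightarrow> real) \<Rightarrow>
   real^3 \<Rightarrow> real^3 \<Rightarrow> real^3 \<Rightarrow> real \<Rightarrow> bool" where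
  "relative_equilibrium A C D U R0 P0 G0 N \<longleftrightarrow> R0 \<in> D \<and>
     solves_eom A C D U
       (\<lambda>t. rot3 (N * t) *v R0) (\<lambda>t. rot3 (N * t) *v P0) (\<lambda>t. rot3 (N * t) *v G0)"

definition locally_central :: "(real^3 \<Rightarrow> real) \<Rightarrow> real^3 \<Rightarrow> bool" where
  "locally_central U R0 \<longleftrightarrow> cross3 R0 (grad U R0) = 0"

definition total_angular_momentum :: "real^3 \<Rightarrow> real^3 \<Rightarrow> real^3 \<Rightarrow> real^3" where
  "total_angular_momentum R P G = cross3 R P + G"

definition inclined_coplanar_precession ::
  "real \<Rightarrow> real \<Rightarrow> (real^3) set \<Rightarrow> (real^3 \<Rightarrow> real) \<Rightarrow> real \<Rightarrow>
   real^3 \<Rightarrow> real^3 \<Rightarrow> real^3 \<Rightarrow> real \<Rightarrow> bool" where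
  "inclined_coplanar_precession A C D U L R0 P0 G0 N \<longleftrightarrow>
     relative_equilibrium A C D U R0 P0 G0 N \<and>
     locally_central U R0 \<and>
     norm (total_angular_momentum R0 P0 G0) = L \<and>
     A * Omega_tilde A C G0 N $ 3 = C * Omega A C G0 $ 3"

text \<open>\<open>cyl U\<close> is the potential in cylindrical coordinates. When \<open>U\<close> lives on an open set that is
  invariant under rotations about the third axis, \<open>cyl U\<close> makes sense for negative \<open>\<rho>\<close> as well,
  so the derivative at \<open>\<rho> = 0\<close> is an ordinary two-sided one.\<close>

definition cyl :: "(real^3 \<Rightarrow> real) \<Rightarrow> real \<Rightarrow> real \<Rightarrow> real" where
  "cyl U \<rho> z = U (vector [\<rho>, 0, z])"

definition cyl_rho :: "(real^3 \<Rightarrow> real) \<Rightarrow> real \<Rightarrow> real \<Rightarrow> real" where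
  "cyl_rho U \<rho> z = deriv (\<lambda>r. cyl U r z) \<rho>"

definition cyl_3 :: "(real^3 \<Rightarrow> real) \<Rightarrow> real \<Rightarrow> real \<Rightarrow> real" where
  "cyl_3 U \<rho> z = deriv (\<lambda>w. cyl U \<rho> w) z"

definition precession_G :: "real \<Rightarrow> real \<Rightarrow> real \<Rightarrow> real \<Rightarrow> real \<Rightarrow> real^3" where
  "precession_G A R1 R3 a1 a2 =
     (a1 * A) *\<^sub>R vector [0, 1, 0] +
     (a2 * (A / norm (vector [R1, 0, R3] :: real^3))) *\<^sub>R vector [R3, 0, - R1]"

end

theory Submission
  imports Defs
begin

text \<open>Axial symmetry makes \<open>U\<close> invariant and \<open>grad U\<close> equivariant under rotations about the third
  axis, so the equations of motion along the rotating curve reduce to algebraic equations at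
  \<open>t = 0\<close>: with \<open>W = Omega_tilde\<close>, these are \<open>P0 = W \<times> R0\<close>, \<open>W \<times> P0 = - grad U R0\<close> and
  \<open>W \<times> G0 = R0 \<times> grad U R0\<close>. The condition on the third components says precisely that
  \<open>W = G0 / A\<close>, so the force balance becomes \<open>A\<^sup>2 grad U R0 = |G0|\<^sup>2 R0 - \<langle>G0, R0\<rangle> G0\<close>.
  Crossing with \<open>R0\<close> leaves \<open>\<langle>G0, R0\<rangle> R0 \<times> G0 = 0\<close>, and \<open>R0 \<times> G0 = 0\<close> is impossible because then
  \<open>P0\<close> and hence the gradient would vanish; thus \<open>G0\<close> is orthogonal to \<open>R0\<close>, and the total angular
  momentum is \<open>(|R0|\<^sup>2 + A) / A\<close> times \<open>G0\<close>.\<close>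

section \<open>Rotations about the third axis\<close>

lemma rot3_mult: "rot3 \<phi> *v x =
    vector [cos \<phi> * x$1 - sin \<phi> * x$2, sin \<phi> * x$1 + cos \<phi> * x$2, x$3]"
  by (simp add: vec_eq_iff forall_3 rot3_def matrix_vector_mult_def sum_3)

lemma rot3_zero: "rot3 0 *v x = x"
  by (simp add: rot3_mult vec_eq_iff forall_3)

lemma rot3_add: "rot3 \<phi> *v (rot3 \<psi> *v x) = rot3 (\<phi> + \<psi>) *v x"
  by (simp add: rot3_mult vec_eq_iff forall_3 cos_add sin_add algebra_simps)

lemma rot3_cancel: "rot3 (-\<phi>) *v (rot3 \<phi> *v x) = x" "rot3 \<phi> *v (rot3 (-\<phi>) *v x) = x"
  by (simp_all add: rot3_add rot3_zero)

lemma rot3_eq_iff: "rot3 \<phi> *v x = rot3 \<phi> *v y \<longleftrightarrow> x = y"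
  by (metis rot3_cancel(1))

lemma inner_rot3: "(rot3 \<phi> *v x) \<bullet> y = x \<bullet> (rot3 (-\<phi>) *v y)"
  by (simp add: rot3_mult inner_vec_def sum_3 algebra_simps)

lemma inner_rot3_rot3: "(rot3 \<phi> *v x) \<bullet> (rot3 \<phi> *v y) = x \<bullet> y"
  by (simp add: inner_rot3 rot3_cancel)

lemma norm_rot3: "norm (rot3 \<phi> *v x) = norm x"
  by (simp add: norm_eq_sqrt_inner inner_rot3_rot3)

text \<open>A rotation is orthogonal with determinant one, so it respects the cross product. In
  coordinates only the third component needs \<open>sin\<close> and \<open>cos\<close> squared to
  sum to one; the other two are linear in \<open>cos\<close> and \<open>sin\<close>.\<close>

lemma cross3_rot3: "cross3 (rot3 \<phi> *v x) (rot3 \<phi> *v y) = rot3 \<phi> *v cross3 x y"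
proof -
  let ?c = "cos \<phi>" and ?s = "sin \<phi>"
  have "(?c * x$1 - ?s * x$2) * (?s * y$1 + ?c * y$2) - (?s * x$1 + ?c * x$2) * (?c * y$1 - ?s * y$2)
      = (?s\<^sup>2 + ?c\<^sup>2) * (x$1 * y$2 - x$2 * y$1)"
    unfolding power2_eq_square ring_distribs left_diff_distrib right_diff_distrib
    by (simp only: ac_simps)
  also have "\<dots> = x$1 * y$2 - x$2 * y$1" by simp
  finally show ?thesis
    unfolding rot3_mult cross3_def vec_eq_iff forall_3 vector_3
    by (intro conjI) (simp add: algebra_simps, simp add: algebra_simps, assumption)
qed

lemma rot3_third_axis: "rot3 \<phi> *v vector [0, 0, a] = vector [0, 0, a]"
  by (simp add: rot3_mult)

text \<open>Uniform rotation about the third axis with rate \<open>N\<close> has constant angular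
  velocity \<open>[0, 0, N]\<close>, so its velocity is the cross product with that vector.\<close>

lemma rot3_has_vector_derivative:
  "((\<lambda>t. rot3 (N * t) *v x) has_vector_derivative
     cross3 (vector [0, 0, N]) (rot3 (N * t) *v x)) (at t)"
proof -
  \<comment> \<open>Constant vectors carrying the \<open>cos\<close>, \<open>sin\<close> and axial
    parts of the curve, so that only scalar functions have to be differentiated.\<close>
  define a b c :: "real^3"
    where "a = vector [x$1, x$2, 0]" and "b = vector [- x$2, x$1, 0]" and "c = vector [0, 0, x$3]"
  have split: "rot3 \<phi> *v x = cos \<phi> *\<^sub>R a + sin \<phi> *\<^sub>R b + c" for \<phi>
    by (simp add: rot3_mult vec_eq_iff forall_3 a_def b_def c_def)
  have "((\<lambda>t. cos (N * t) *\<^sub>R a + sin (N * t) *\<^sub>R b + c) has_vector_derivative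
      (- sin (N * t) * N) *\<^sub>R a + (cos (N * t) * N) *\<^sub>R b) (at t)"
    by (auto intro!: derivative_eq_intros)
  moreover have "(- sin (N * t) * N) *\<^sub>R a + (cos (N * t) * N) *\<^sub>R b
      = cross3 (vector [0, 0, N]) (rot3 (N * t) *v x)"
    by (simp add: rot3_mult vec_eq_iff forall_3 cross3_def a_def b_def algebra_simps)
  ultimately show ?thesis by (simp only: split)
qed

section \<open>The inertia matrix and the angular velocity\<close>

lemma matrix_inv_eqI:
  assumes "M ** K = mat 1" "K ** M = mat 1"
  shows "matrix_inv M = K"
proof -
  \<comment> \<open>\<open>matrix_inv\<close> is defined by choice; the given two-sided inverse
    \<open>K\<close> shows that the choice succeeds, and uniqueness of inverses then yields
    \<open>K\<close>.\<close>
  have "matrix_inv M ** M = mat 1"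
    unfolding matrix_inv_def
    by (rule someI2[where P = "\<lambda>K. M ** K = mat 1 \<and> K ** M = mat 1"]) (use assms in auto)
  then show ?thesis
    by (metis assms(1) matrix_mul_assoc matrix_mul_lid matrix_mul_rid)
qed

lemma Omega_eq:
  assumes "A > 0" "C > 0"
  shows "Omega A C G = vector [G$1 / A, G$2 / A, G$3 / C]"
proof -
  have "inertia A C ** inertia (1/A) (1/C) = mat 1" "inertia (1/A) (1/C) ** inertia A C = mat 1"
    using assms
    by (simp_all add: inertia_def matrix_matrix_mult_def vec_eq_iff forall_3 sum_3 mat_def)
  then have "matrix_inv (inertia A C) = inertia (1/A) (1/C)"
    by (rule matrix_inv_eqI)
  then show ?thesis
    by (simp add: Omega_def inertia_def matrix_vector_mult_def vec_eq_iff forall_3 sum_3)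
qed

text \<open>The first two principal moments coincide, so the inertia matrix commutes with rotations
  about the third axis.\<close>

lemma Omega_rot3:
  assumes "A > 0" "C > 0"
  shows "Omega A C (rot3 \<phi> *v G) = rot3 \<phi> *v Omega A C G"
  using assms by (simp add: Omega_eq rot3_mult vec_eq_iff forall_3 field_simps)

section \<open>Differentiability and the gradient\<close>

lemma has_derivative_grad:
  assumes "U differentiable (at x)"
  shows "(U has_derivative (\<lambda>h. grad U x \<bullet> h)) (at x)"
proof -
  define f where "f = frechet_derivative U (at x)"
  have der: "(U has_derivative f) (at x)"
    using assms by (simp add: f_def frechet_derivative_works)
  then have lin: "linear f" by (rule has_derivative_linear)
  have "f h = grad U x \<bullet> h" for h
  proof -
    \<comment> \<open>By linearity the derivative is determined by its values on the axis vectors,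
      which are the components of \<open>grad\<close>.\<close>
    have "f h = f (\<Sum>i\<in>UNIV. h$i *\<^sub>R axis i 1)"
      using basis_expansion[of h] by (simp add: scalar_mult_eq_scaleR)
    also have "\<dots> = (\<Sum>i\<in>UNIV. h$i * f (axis i 1))"
      by (simp add: linear_sum[OF lin] linear_cmul[OF lin])
    also have "\<dots> = grad U x \<bullet> h"
      by (simp add: grad_def f_def inner_vec_def mult.commute)
    finally show ?thesis .
  qed
  then have "f = (\<lambda>h. grad U x \<bullet> h)" by auto
  then show ?thesis using der by simp
qed

lemma smooth_on_differentiable:
  assumes "smooth_on D U" "open D" "x \<in> D"
  shows "U differentiable (at x)"
proof -
  have "Ck_on (Suc 0) D U" using assms(1) unfolding smooth_on_def by blast
  then show ?thesis
    using assms(2,3) by (simp add: differentiable_on_eq_differentiable_at)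
qed

section \<open>Axial symmetry of the potential\<close>

locale axisymmetric_potential =
  fixes D :: "(real^3) set" and U :: "real^3 \<Rightarrow> real"
  assumes open_D: "open D"
    and rot3_D: "\<And>\<phi> x. x \<in> D \<Longrightarrow> rot3 \<phi> *v x \<in> D"
    and diff_U: "\<And>x. x \<in> D \<Longrightarrow> U differentiable (at x)"
    and axial: "\<And>x. x \<in> D \<Longrightarrow> x $ 1 * grad U x $ 2 - x $ 2 * grad U x $ 1 = 0"
begin

text \<open>The orbit of \<open>x\<close> stays in \<open>D\<close> and moves with velocity
  \<open>[0, 0, 1]\<close> cross position. The hypothesis \<open>axial\<close> says that the
  gradient is orthogonal to this velocity, so \<open>U\<close> has zero derivative along the whole
  orbit.\<close>

lemma rot3_invariant:
  assumes "x \<in> D"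
  shows "U (rot3 \<phi> *v x) = U x"
proof -
  have "DERIV (\<lambda>t. U (rot3 t *v x)) t :> 0" for t
  proof -
    let ?y = "rot3 t *v x"
    have y: "?y \<in> D" using assms rot3_D by blast
    have "((\<lambda>t. rot3 (1 * t) *v x) has_derivative
        (\<lambda>h. h *\<^sub>R cross3 (vector [0, 0, 1]) (rot3 (1 * t) *v x))) (at t)"
      using rot3_has_vector_derivative[of 1 x t] by (simp add: has_vector_derivative_def)
    then have "((\<lambda>t. rot3 t *v x) has_derivative
        (\<lambda>h. h *\<^sub>R cross3 (vector [0, 0, 1]) ?y)) (at t)"
      by simp
    from has_derivative_compose[OF this has_derivative_grad[OF diff_U[OF y]]]
    have "((\<lambda>t. U (rot3 t *v x)) has_derivative
        (\<lambda>h. grad U ?y \<bullet> (h *\<^sub>R cross3 (vector [0, 0, 1]) ?y))) (at t)" .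
    moreover have "grad U ?y \<bullet> cross3 (vector [0, 0, 1]) ?y = 0"
      using axial[OF y] by (simp add: inner_vec_def sum_3 cross3_def mult.commute)
    ultimately show ?thesis by (simp add: has_field_derivative_def lambda_zero)
  qed
  then have "U (rot3 \<phi> *v x) = U (rot3 0 *v x)" by (intro DERIV_isconst_all) auto
  then show ?thesis by (simp add: rot3_zero)
qed

text \<open>Differentiate the invariance of \<open>U\<close> and move the rotation across the inner
  product, where its adjoint is its inverse.\<close>

lemma grad_rot3:
  assumes "x \<in> D"
  shows "grad U (rot3 \<phi> *v x) = rot3 \<phi> *v grad U x"
proof -
  have "((\<lambda>y. rot3 \<phi> *v y) has_derivative (\<lambda>h. rot3 \<phi> *v h)) (at x)"
    by (simp add: bounded_linear_imp_has_derivative)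
  from has_derivative_compose[OF this has_derivative_grad[OF diff_U[OF rot3_D[OF assms]]]]
  have "((\<lambda>y. U (rot3 \<phi> *v y)) has_derivative
      (\<lambda>h. grad U (rot3 \<phi> *v x) \<bullet> (rot3 \<phi> *v h))) (at x)" .
  \<comment> \<open>Invariance is available only on \<open>D\<close>; openness of \<open>D\<close>
    lets the derivative pass from the rotated function to \<open>U\<close>.\<close>
  then have "(U has_derivative (\<lambda>h. grad U (rot3 \<phi> *v x) \<bullet> (rot3 \<phi> *v h))) (at x)"
    by (rule has_derivative_transform_within_open[OF _ open_D assms]) (rule rot3_invariant)
  then have eq: "grad U (rot3 \<phi> *v x) \<bullet> (rot3 \<phi> *v h) = grad U x \<bullet> h" for h
    using has_derivative_unique[OF _ has_derivative_grad[OF diff_U[OF assms]]] by metis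
  have "grad U (rot3 \<phi> *v x) \<bullet> h = (rot3 \<phi> *v grad U x) \<bullet> h" for h
    using eq[of "rot3 (-\<phi>) *v h"] by (simp add: rot3_cancel inner_rot3)
  then show ?thesis by (metis vector_eq_rdot)
qed

section \<open>Relative equilibria as algebraic equations\<close>

lemma relative_equilibrium_iff:
  assumes "A > 0" "C > 0"
  shows "relative_equilibrium A C D U R0 P0 G0 N \<longleftrightarrow> R0 \<in> D \<and>
     P0 = cross3 (Omega_tilde A C G0 N) R0 \<and>
     cross3 (Omega_tilde A C G0 N) P0 = - grad U R0 \<and>
     cross3 (Omega_tilde A C G0 N) G0 = cross3 R0 (grad U R0)"
proof -
  define W where "W = Omega A C G0"
  define Z :: "real^3" where "Z = vector [0, 0, N]"
  have Wt: "Omega_tilde A C G0 N = W + Z" by (simp add: Omega_tilde_def W_def Z_def)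
  \<comment> \<open>All three equations of motion have this shape, with \<open>y\<close> being
    \<open>P0\<close>, \<open>- grad U R0\<close> and \<open>cross3 R0 (grad U R0)\<close> in turn.
    Uniqueness of the derivative turns each into a vector equation from which the rotation, and with
    it \<open>t\<close>, cancels.\<close>
  have derivative_iff: "((\<lambda>t. rot3 (N * t) *v x) has_vector_derivative
      cross3 (rot3 (N * t) *v x) (rot3 (N * t) *v W) + rot3 (N * t) *v y) (at t)
      \<longleftrightarrow> y = cross3 (W + Z) x" for x y t
  proof -
    let ?Q = "\<lambda>x. rot3 (N * t) *v x"
    have "((\<lambda>t. rot3 (N * t) *v x) has_vector_derivative
      cross3 (?Q x) (?Q W) + ?Q y) (at t) \<longleftrightarrow>
      cross3 (?Q x) (?Q W) + ?Q y = cross3 Z (?Q x)"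
      using rot3_has_vector_derivative[of N x t] vector_derivative_unique_at
      unfolding Z_def by metis
    \<comment> \<open>\<open>Z\<close> lies on the axis of rotation, so it can be written as rotated
      and the common rotation pulled out of both sides.\<close>
    also have "Z = ?Q Z" by (simp add: Z_def rot3_third_axis)
    also have "cross3 (?Q x) (?Q W) + ?Q y = cross3 (?Q Z) (?Q x) \<longleftrightarrow>
        ?Q (cross3 x W + y) = ?Q (cross3 Z x)"
      by (simp add: cross3_rot3 matrix_vector_right_distrib)
    also have "\<dots> \<longleftrightarrow> y = cross3 (W + Z) x"
      unfolding rot3_eq_iff by (auto simp: cross3_def vec_eq_iff forall_3 algebra_simps)
    finally show ?thesis .
  qed
  have minus: "rot3 \<phi> *v (- x) = - (rot3 \<phi> *v x)" for \<phi> x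
    by (simp add: rot3_mult vec_eq_iff forall_3)
  show ?thesis
  proof (cases "R0 \<in> D")
    case True
    have "solves_eom A C D U
       (\<lambda>t. rot3 (N * t) *v R0) (\<lambda>t. rot3 (N * t) *v P0) (\<lambda>t. rot3 (N * t) *v G0)
      \<longleftrightarrow> P0 = cross3 (W + Z) R0 \<and> - grad U R0 = cross3 (W + Z) P0 \<and>
        cross3 R0 (grad U R0) = cross3 (W + Z) G0"
      unfolding solves_eom_def Omega_rot3[OF assms] W_def[symmetric] grad_rot3[OF True]
        cross3_rot3[of _ R0 "grad U R0"] diff_conv_add_uminus minus[symmetric] derivative_iff
      using rot3_D[OF True] by auto
    then show ?thesis using True unfolding relative_equilibrium_def Wt by metis
  qed (simp add: relative_equilibrium_def)
qed

section \<open>The gradient in cylindrical coordinates\<close>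

lemma grad_half_plane:
  assumes "vector [\<rho>, 0, z] \<in> D"
  shows "grad U (vector [\<rho>, 0, z]) = vector [cyl_rho U \<rho> z, 0, cyl_3 U \<rho> z]"
proof -
  let ?x = "vector [\<rho>, 0, z] :: real^3"
  note der = has_derivative_grad[OF diff_U[OF assms]]
  have "((\<lambda>r. vector [r, 0, z] :: real^3) has_derivative (\<lambda>h. h *\<^sub>R vector [1, 0, 0])) (at \<rho>)"
  proof -
    have "(\<lambda>r. vector [r, 0, z] :: real^3) = (\<lambda>r. r *\<^sub>R vector [1, 0, 0] + vector [0, 0, z])"
      by (auto simp: vec_eq_iff forall_3)
    then show ?thesis by (auto intro!: derivative_eq_intros)
  qed
  from has_derivative_compose[OF this der]
  have "DERIV (\<lambda>r. cyl U r z) \<rho> :> grad U ?x $ 1"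
    by (simp add: has_field_derivative_def cyl_def inner_vec_def sum_3 mult_commute_abs)
  then have 1: "cyl_rho U \<rho> z = grad U ?x $ 1" by (simp add: cyl_rho_def DERIV_imp_deriv)
  have "((\<lambda>w. vector [\<rho>, 0, w] :: real^3) has_derivative (\<lambda>h. h *\<^sub>R vector [0, 0, 1])) (at z)"
  proof -
    have "(\<lambda>w. vector [\<rho>, 0, w] :: real^3) = (\<lambda>w. w *\<^sub>R vector [0, 0, 1] + vector [\<rho>, 0, 0])"
      by (auto simp: vec_eq_iff forall_3)
    then show ?thesis by (auto intro!: derivative_eq_intros)
  qed
  from has_derivative_compose[OF this der]
  have "DERIV (\<lambda>w. cyl U \<rho> w) z :> grad U ?x $ 3"
    by (simp add: has_field_derivative_def cyl_def inner_vec_def sum_3 mult_commute_abs)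
  then have 3: "cyl_3 U \<rho> z = grad U ?x $ 3" by (simp add: cyl_3_def DERIV_imp_deriv)
  have 2: "grad U ?x $ 2 = 0"
  proof (cases "\<rho> = 0")
    case True
    \<comment> \<open>On the axis \<open>axial\<close> is void; use equivariance under the half turn instead.\<close>
    then have "rot3 pi *v ?x = ?x" by (simp add: rot3_third_axis)
    then have "grad U ?x = rot3 pi *v grad U ?x" using grad_rot3[OF assms, of pi] by simp
    then have "grad U ?x $ 2 = (rot3 pi *v grad U ?x) $ 2" by simp
    also have "\<dots> = - grad U ?x $ 2" by (simp add: rot3_mult)
    finally show ?thesis by simp
  next
    case False
    then show ?thesis using axial[OF assms] by simp
  qed
  show ?thesis using 1 2 3 by (simp add: vec_eq_iff forall_3)
qed

text \<open>Both sides of the equation are equivariant, so \<open>R0\<close> may be rotated by its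
  azimuth into the half-plane of vanishing second coordinate. There the second component of the
  equation is trivial.\<close>

lemma central_equation_cyl_iff:
  assumes "R0 \<in> D" and \<rho>: "\<rho> = sqrt ((R0 $ 1)\<^sup>2 + (R0 $ 2)\<^sup>2)"
  shows "k *\<^sub>R R0 = grad U R0 \<longleftrightarrow>
    \<rho> * k = cyl_rho U \<rho> (R0 $ 3) \<and> R0 $ 3 * k = cyl_3 U \<rho> (R0 $ 3)"
proof -
  let ?x = "vector [\<rho>, 0, R0 $ 3] :: real^3"
  obtain \<phi> where "R0 $ 1 = \<rho> * cos \<phi>" "R0 $ 2 = \<rho> * sin \<phi>"
  proof -
    \<comment> \<open>The azimuth is obtained as a complex argument; the polar identities used also
      hold on the axis, where the modulus is zero.\<close>
    let ?z = "Complex (R0 $ 1) (R0 $ 2)"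
    have "Re ?z = cmod ?z * cos (Arg ?z)" "Im ?z = cmod ?z * sin (Arg ?z)"
      using Re_rcis[of "cmod ?z" "Arg ?z"] Im_rcis[of "cmod ?z" "Arg ?z"]
      unfolding rcis_cmod_Arg by blast+
    moreover have "cmod ?z = \<rho>" by (simp add: \<rho> cmod_def)
    ultimately show ?thesis using that[of "Arg ?z"] by simp
  qed
  then have R0: "R0 = rot3 \<phi> *v ?x"
    by (simp add: rot3_mult vec_eq_iff forall_3 mult.commute)
  then have x: "?x \<in> D" using rot3_D[OF assms(1)] by (metis rot3_cancel(1))
  have "k *\<^sub>R R0 = grad U R0 \<longleftrightarrow> rot3 \<phi> *v (k *\<^sub>R ?x) = rot3 \<phi> *v grad U ?x"
    using R0 grad_rot3[OF x, of \<phi>] by (metis matrix_vector_mult_scaleR)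
  also have "\<dots> \<longleftrightarrow> k *\<^sub>R ?x = grad U ?x" by (rule rot3_eq_iff)
  also have "\<dots> \<longleftrightarrow> \<rho> * k = cyl_rho U \<rho> (R0 $ 3) \<and> R0 $ 3 * k = cyl_3 U \<rho> (R0 $ 3)"
    unfolding grad_half_plane[OF x] by (auto simp: vec_eq_iff forall_3 mult.commute)
  finally show ?thesis .
qed

section \<open>Characterization of inclined co-planar precessions\<close>

lemma inclined_coplanar_precession_iff:
  assumes AC: "A > 0" "C > 0" and L: "L \<ge> 0" and R0: "R0 \<in> D" and grad: "grad U R0 \<noteq> 0"
  shows "inclined_coplanar_precession A C D U L R0 P0 G0 N \<longleftrightarrow>
    (L\<^sup>2 / ((norm R0)\<^sup>2 + A)\<^sup>2) *\<^sub>R R0 = grad U R0 \<and>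
    G0 \<bullet> R0 = 0 \<and>
    norm G0 = A * L / ((norm R0)\<^sup>2 + A) \<and>
    P0 = (1 / A) *\<^sub>R cross3 G0 R0 \<and>
    N = (C - A) / A * Omega A C G0 $ 3"
proof -
  let ?W = "Omega_tilde A C G0 N" and ?S = "(norm R0)\<^sup>2 + A"
  have S: "?S > 0" using AC by (simp add: add_nonneg_pos)
  have N_iff: "N = (C - A) / A * Omega A C G0 $ 3 \<longleftrightarrow> A * ?W $ 3 = C * Omega A C G0 $ 3"
    using AC by (simp add: Omega_tilde_def field_simps)
  \<comment> \<open>The first two components agree because both transverse moments equal
    \<open>A\<close>; the condition on the third components supplies the rest.\<close>
  have W: "?W = (1/A) *\<^sub>R G0" if "A * ?W $ 3 = C * Omega A C G0 $ 3"
    using that AC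
    by (simp add: Omega_tilde_def Omega_eq vec_eq_iff forall_3 field_simps)
  have torque: "cross3 G0 (cross3 G0 R0) = (G0 \<bullet> R0) *\<^sub>R G0 - (norm G0)\<^sup>2 *\<^sub>R R0"
    unfolding Lagrange power2_norm_eq_inner ..
  have momentum: "total_angular_momentum R0 ((1 / A) *\<^sub>R cross3 G0 R0) G0 = (?S / A) *\<^sub>R G0"
    if "G0 \<bullet> R0 = 0"
  proof -
    have "cross3 R0 (cross3 G0 R0) = (norm R0)\<^sup>2 *\<^sub>R G0"
      using that by (simp add: Lagrange power2_norm_eq_inner inner_commute)
    then show ?thesis using AC
      by (simp add: total_angular_momentum_def cross_mult_right add_divide_distrib
          scaleR_add_left)
  qed
  have norm_iff: "norm ((?S / A) *\<^sub>R G0) = L \<longleftrightarrow> norm G0 = A * L / ?S"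
    using S AC by (auto simp: field_simps)
  \<comment> \<open>Links the factor of \<open>R0\<close> coming from the force balance to the one
    expressed through \<open>L\<close>.\<close>
  have coeff: "(norm G0 / A)\<^sup>2 = L\<^sup>2 / ?S\<^sup>2" if "norm G0 = A * L / ?S"
    using AC unfolding that by (simp add: power_divide)
  show ?thesis
  proof
    assume asm: "inclined_coplanar_precession A C D U L R0 P0 G0 N"
    then have req: "P0 = cross3 ?W R0" "cross3 ?W P0 = - grad U R0"
      and central: "cross3 R0 (grad U R0) = 0"
      and normL: "norm (total_angular_momentum R0 P0 G0) = L"
      and third: "A * ?W $ 3 = C * Omega A C G0 $ 3"
      unfolding inclined_coplanar_precession_def relative_equilibrium_iff[OF AC]
        locally_central_def by auto
    have P0: "P0 = (1 / A) *\<^sub>R cross3 G0 R0"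
      using req(1) W[OF third] by (simp add: cross_mult_left)
    have "- grad U R0 = (1/A)\<^sup>2 *\<^sub>R cross3 G0 (cross3 G0 R0)"
      using req(2) W[OF third] P0
      by (simp add: cross_mult_left cross_mult_right power2_eq_square)
    then have force: "grad U R0 = - ((1/A)\<^sup>2 *\<^sub>R cross3 G0 (cross3 G0 R0))"
      by (metis minus_minus)
    then have "cross3 G0 R0 \<noteq> 0" using grad by auto
    moreover have "(G0 \<bullet> R0) *\<^sub>R cross3 R0 G0 = 0"
    proof -
      have "cross3 R0 (cross3 G0 (cross3 G0 R0)) = 0"
        using central force AC by (simp add: cross_mult_right cross_minus_right)
      then show ?thesis
        unfolding torque by (simp add: Cross3.right_diff_distrib cross_mult_right)
    qed
    ultimately have orth: "G0 \<bullet> R0 = 0"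
      by (metis cross_skew neg_equal_0_iff_equal scaleR_eq_0_iff)
    have "norm G0 = A * L / ?S"
      using normL norm_iff momentum[OF orth] P0 by simp
    moreover have "grad U R0 = (norm G0 / A)\<^sup>2 *\<^sub>R R0"
      using force orth torque by (simp add: power_divide)
    ultimately show "(L\<^sup>2 / ?S\<^sup>2) *\<^sub>R R0 = grad U R0 \<and> G0 \<bullet> R0 = 0 \<and>
        norm G0 = A * L / ?S \<and> P0 = (1 / A) *\<^sub>R cross3 G0 R0 \<and>
        N = (C - A) / A * Omega A C G0 $ 3"
      using coeff orth P0 third N_iff by simp
  next
    assume "(L\<^sup>2 / ?S\<^sup>2) *\<^sub>R R0 = grad U R0 \<and> G0 \<bullet> R0 = 0 \<and>
        norm G0 = A * L / ?S \<and> P0 = (1 / A) *\<^sub>R cross3 G0 R0 \<and>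
        N = (C - A) / A * Omega A C G0 $ 3"
    then have force: "grad U R0 = (norm G0 / A)\<^sup>2 *\<^sub>R R0" and orth: "G0 \<bullet> R0 = 0"
      and normG: "norm G0 = A * L / ?S" and P0: "P0 = (1 / A) *\<^sub>R cross3 G0 R0"
      and third: "A * ?W $ 3 = C * Omega A C G0 $ 3"
      using coeff N_iff by auto
    have central: "cross3 R0 (grad U R0) = 0"
      unfolding force by (simp add: cross_mult_right)
    moreover have "cross3 ((1/A) *\<^sub>R G0) P0 = - grad U R0"
      unfolding P0 force using torque orth
      by (simp add: cross_mult_left cross_mult_right power_divide power2_eq_square)
    ultimately have "relative_equilibrium A C D U R0 P0 G0 N"
      unfolding relative_equilibrium_iff[OF AC] W[OF third]
      using R0 P0 by (simp add: cross_mult_left)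
    then show "inclined_coplanar_precession A C D U L R0 P0 G0 N"
      unfolding inclined_coplanar_precession_def locally_central_def
      using central third momentum[OF orth] norm_iff normG P0 by simp
  qed
qed

end

lemma precession_G_nth:
  "precession_G A R1 R3 a1 a2 $ 1 = a2 * (A / norm (vector [R1, 0, R3] :: real^3)) * R3"
  "precession_G A R1 R3 a1 a2 $ 2 = a1 * A"
  "precession_G A R1 R3 a1 a2 $ 3 = - (a2 * (A / norm (vector [R1, 0, R3] :: real^3)) * R1)"
  by (simp_all add: precession_G_def)

lemma norm_vector_half_plane: "(norm (vector [x, 0, z] :: real^3))\<^sup>2 = x\<^sup>2 + z\<^sup>2"
  unfolding power2_norm_eq_inner inner_vec_def sum_3 by (simp add: power2_eq_square)

lemma norm_precession_G:
  assumes "R1 \<noteq> 0"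
  shows "(norm (precession_G A R1 R3 a1 a2))\<^sup>2 = A\<^sup>2 * (a1\<^sup>2 + a2\<^sup>2)"
proof -
  define n where "n = norm (vector [R1, 0, R3] :: real^3)"
  have n: "n\<^sup>2 = R1\<^sup>2 + R3\<^sup>2" unfolding n_def by (rule norm_vector_half_plane)
  then have n0: "n \<noteq> 0" using assms by (auto simp: sum_power2_eq_zero_iff)
  have "(norm (precession_G A R1 R3 a1 a2))\<^sup>2 = (a2 * (A / n))\<^sup>2 * n\<^sup>2 + (a1 * A)\<^sup>2"
    unfolding n power2_norm_eq_inner inner_vec_def sum_3 inner_real_def precession_G_nth n_def[symmetric]
    by algebra
  also have "\<dots> = A\<^sup>2 * (a1\<^sup>2 + a2\<^sup>2)"
    using n0 by (simp add: power_mult_distrib power_divide algebra_simps)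
  finally show ?thesis .
qed

lemma inner_precession_G: "precession_G A R1 R3 a1 a2 \<bullet> vector [R1, 0, R3] = 0"
  by (simp add: inner_vec_def sum_3 precession_G_nth)

lemma precession_G_inject:
  assumes "A \<noteq> 0" "R1 \<noteq> 0" "precession_G A R1 R3 a1 a2 = precession_G A R1 R3 b1 b2"
  shows "a1 = b1 \<and> a2 = b2"
proof -
  have "(vector [R1, 0, R3] :: real^3) \<noteq> 0"
    using assms(2) by (metis vector_3(1) zero_index)
  moreover have "precession_G A R1 R3 a1 a2 $ 2 = precession_G A R1 R3 b1 b2 $ 2"
    "precession_G A R1 R3 a1 a2 $ 3 = precession_G A R1 R3 b1 b2 $ 3"
    using assms(3) by simp_all
  ultimately show ?thesis using assms(1,2) by (simp add: precession_G_nth)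
qed

lemma orthogonal_imp_precession_G:
  assumes "A \<noteq> 0" "R1 \<noteq> 0" "G \<bullet> vector [R1, 0, R3] = 0"
  obtains a1 a2 where "G = precession_G A R1 R3 a1 a2"
proof
  define n where "n = norm (vector [R1, 0, R3] :: real^3)"
  have "(vector [R1, 0, R3] :: real^3) \<noteq> 0"
    using assms(2) by (metis vector_3(1) zero_index)
  then have n: "n \<noteq> 0" by (simp add: n_def)
  have "G $ 1 * R1 + G $ 3 * R3 = 0" using assms(3) by (simp add: inner_vec_def sum_3)
  then have "G $ 1 = - (G $ 3 * R3) / R1" using assms(2) by (simp add: field_simps)
  then show "G = precession_G A R1 R3 (G $ 2 / A) (- (G $ 3 * n) / (A * R1))"
    using n assms(1,2) by (simp add: vec_eq_iff forall_3 precession_G_nth n_def[symmetric])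
qed

theorem mainTheorem3:
  fixes A C L :: real and D :: "(real^3) set" and U :: "real^3 \<Rightarrow> real"
  assumes "A > 0" and "C > 0" and "L \<ge> 0"
    and "open D" and "0 \<notin> D"
    and "\<And>\<phi> x. x \<in> D \<Longrightarrow> rot3 \<phi> *v x \<in> D"
    and "smooth_on D U"
    and "\<And>x. x \<in> D \<Longrightarrow> x $ 1 * grad U x $ 2 - x $ 2 * grad U x $ 1 = 0"
  shows
    "(\<forall>R0 P0 G0 N. R0 \<in> D \<longrightarrow> grad U R0 \<noteq> 0 \<longrightarrow>
        (inclined_coplanar_precession A C D U L R0 P0 G0 N \<longleftrightarrow>
           (L\<^sup>2 / ((norm R0)\<^sup>2 + A)\<^sup>2) *\<^sub>R R0 = grad U R0 \<and>
           G0 \<bullet> R0 = 0 \<and>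
           norm G0 = A * L / ((norm R0)\<^sup>2 + A) \<and>
           P0 = (1 / A) *\<^sub>R cross3 G0 R0 \<and>
           N = (C - A) / A * Omega A C G0 $ 3))
   \<and> (\<forall>R0\<in>D. \<forall>\<rho>. \<rho> = sqrt ((R0 $ 1)\<^sup>2 + (R0 $ 2)\<^sup>2) \<longrightarrow>
        ((L\<^sup>2 / ((norm R0)\<^sup>2 + A)\<^sup>2) *\<^sub>R R0 = grad U R0 \<longleftrightarrow>
           \<rho> * (L\<^sup>2 / ((R0 $ 3)\<^sup>2 + \<rho>\<^sup>2 + A)\<^sup>2) = cyl_rho U \<rho> (R0 $ 3) \<and>
           R0 $ 3 * (L\<^sup>2 / ((R0 $ 3)\<^sup>2 + \<rho>\<^sup>2 + A)\<^sup>2) = cyl_3 U \<rho> (R0 $ 3)))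
   \<and> (\<forall>R0 R1 R3. R0 = vector [R1, 0, R3] \<longrightarrow> R0 \<in> D \<longrightarrow> R1 * R3 \<noteq> 0 \<longrightarrow>
        (L\<^sup>2 / ((norm R0)\<^sup>2 + A)\<^sup>2) *\<^sub>R R0 = grad U R0 \<longrightarrow> grad U R0 \<noteq> 0 \<longrightarrow>
          {G0. \<exists>P0 N. inclined_coplanar_precession A C D U L R0 P0 G0 N} =
            {precession_G A R1 R3 a1 a2 | a1 a2.
               a1\<^sup>2 + a2\<^sup>2 = L\<^sup>2 / ((norm R0)\<^sup>2 + A)\<^sup>2} \<and>
          L > 0 \<and>
          bij_betw
            (\<lambda>(a1, a2). let G0 = precession_G A R1 R3 a1 a2 in
               ((1 / A) *\<^sub>R cross3 G0 R0, G0, (C - A) / A * Omega A C G0 $ 3))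
            {(a1, a2). a1\<^sup>2 + a2\<^sup>2 = L\<^sup>2 / ((norm R0)\<^sup>2 + A)\<^sup>2}
            {(P0, G0, N). inclined_coplanar_precession A C D U L R0 P0 G0 N} \<and>
          (\<forall>a1 a2 P0 G0 N. a1\<^sup>2 + a2\<^sup>2 = L\<^sup>2 / ((norm R0)\<^sup>2 + A)\<^sup>2 \<longrightarrow>
             G0 = precession_G A R1 R3 a1 a2 \<longrightarrow>
             inclined_coplanar_precession A C D U L R0 P0 G0 N \<longrightarrow>
               R0 \<bullet> vector [0, 0, 1] = R3 \<and>
               P0 \<bullet> vector [0, 0, 1] = - a1 * R1 \<and>
               cross3 R0 (cross3 (Omega_tilde A C G0 N) R0) \<bullet> vector [0, 0, 1]
                 = - a2 * norm R0 * R1))"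
proof -
  note AC = assms(1,2)
  interpret axisymmetric_potential D U
    using assms(4,6,8) smooth_on_differentiable[OF assms(7,4)] by unfold_locales
  note iff = inclined_coplanar_precession_iff[OF AC assms(3)]
  show ?thesis
  proof (intro conjI[of "\<forall>R0 P0 G0 N. _ R0 P0 G0 N"] conjI[of "\<forall>R0\<in>D. _ R0"], goal_cases)
    case 1
    show ?case using iff by blast
  next
    case 2
    show ?case
    proof (intro ballI allI impI)
      fix R0 :: "real^3" and \<rho> assume R0: "R0 \<in> D" and \<rho>: "\<rho> = sqrt ((R0 $ 1)\<^sup>2 + (R0 $ 2)\<^sup>2)"
      have "(norm R0)\<^sup>2 = (R0 $ 3)\<^sup>2 + \<rho>\<^sup>2"
        unfolding \<rho> power2_norm_eq_inner inner_vec_def sum_3 by (simp add: power2_eq_square)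
      then show "(L\<^sup>2 / ((norm R0)\<^sup>2 + A)\<^sup>2) *\<^sub>R R0 = grad U R0 \<longleftrightarrow>
           \<rho> * (L\<^sup>2 / ((R0 $ 3)\<^sup>2 + \<rho>\<^sup>2 + A)\<^sup>2) = cyl_rho U \<rho> (R0 $ 3) \<and>
           R0 $ 3 * (L\<^sup>2 / ((R0 $ 3)\<^sup>2 + \<rho>\<^sup>2 + A)\<^sup>2) = cyl_3 U \<rho> (R0 $ 3)"
        using central_equation_cyl_iff[OF R0 \<rho>] by simp
    qed
  next
    case 3
    show ?case
    proof (intro allI impI, goal_cases)
      case (1 R0 R1 R3)
      note R0 = 1(1) and R0D = 1(2) and eq = 1(4) and grad = 1(5)
      have R1: "R1 \<noteq> 0" using 1(3) by simp
      let ?S = "(norm R0)\<^sup>2 + A" and ?G = "precession_G A R1 R3"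
      let ?icp = "inclined_coplanar_precession A C D U L R0"
      let ?circle = "\<lambda>a1 a2 :: real. a1\<^sup>2 + a2\<^sup>2 = L\<^sup>2 / ?S\<^sup>2"
      have S: "?S > 0" using AC by (simp add: add_nonneg_pos)
      have "L \<noteq> 0" using eq grad by auto
      then have L: "L > 0" using assms(3) by simp
      have norm_iff: "norm (?G a1 a2) = A * L / ?S \<longleftrightarrow> ?circle a1 a2" for a1 a2
      proof -
        have "norm (?G a1 a2) = A * L / ?S \<longleftrightarrow> (norm (?G a1 a2))\<^sup>2 = (A * L / ?S)\<^sup>2"
          using AC L S by (simp add: power2_eq_iff_nonneg)
        also have "\<dots> \<longleftrightarrow> A\<^sup>2 * (a1\<^sup>2 + a2\<^sup>2) = A\<^sup>2 * (L\<^sup>2 / ?S\<^sup>2)"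
          unfolding norm_precession_G[OF R1] by (simp add: power_divide power_mult_distrib)
        also have "\<dots> \<longleftrightarrow> ?circle a1 a2" using AC by (subst mult_cancel_left) simp
        finally show ?thesis .
      qed
      have icp_iff: "?icp P0 G0 N \<longleftrightarrow> (\<exists>a1 a2. ?circle a1 a2 \<and> G0 = ?G a1 a2 \<and>
          P0 = (1 / A) *\<^sub>R cross3 G0 R0 \<and> N = (C - A) / A * Omega A C G0 $ 3)" for P0 G0 N
      proof -
        have "G0 \<bullet> R0 = 0 \<longleftrightarrow> (\<exists>a1 a2. G0 = ?G a1 a2)"
          unfolding R0 using orthogonal_imp_precession_G[of A R1 G0 R3] AC R1 inner_precession_G
          by (metis less_irrefl)
        then show ?thesis unfolding iff[OF R0D grad] using norm_iff eq by metis
      qed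
      show ?case
      proof (intro conjI)
        show "{G0. \<exists>P0 N. ?icp P0 G0 N} = {?G a1 a2 | a1 a2. ?circle a1 a2}"
          unfolding icp_iff by blast
        show "L > 0" by (rule L)
        show "bij_betw
            (\<lambda>(a1, a2). let G0 = ?G a1 a2 in
               ((1 / A) *\<^sub>R cross3 G0 R0, G0, (C - A) / A * Omega A C G0 $ 3))
            {(a1, a2). ?circle a1 a2} {(P0, G0, N). ?icp P0 G0 N}"
          unfolding bij_betw_def
        proof
          show "inj_on (\<lambda>(a1, a2). let G0 = ?G a1 a2 in
               ((1 / A) *\<^sub>R cross3 G0 R0, G0, (C - A) / A * Omega A C G0 $ 3))
            {(a1, a2). ?circle a1 a2}"
            using precession_G_inject[of A R1 R3] AC R1
            by (auto simp: inj_on_def Let_def)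
          show "(\<lambda>(a1, a2). let G0 = ?G a1 a2 in
               ((1 / A) *\<^sub>R cross3 G0 R0, G0, (C - A) / A * Omega A C G0 $ 3)) `
            {(a1, a2). ?circle a1 a2} = {(P0, G0, N). ?icp P0 G0 N}"
            unfolding icp_iff by (auto simp: Let_def image_iff)
        qed
        show "\<forall>a1 a2 P0 G0 N. ?circle a1 a2 \<longrightarrow> G0 = ?G a1 a2 \<longrightarrow> ?icp P0 G0 N \<longrightarrow>
               R0 \<bullet> vector [0, 0, 1] = R3 \<and>
               P0 \<bullet> vector [0, 0, 1] = - a1 * R1 \<and>
               cross3 R0 (cross3 (Omega_tilde A C G0 N) R0) \<bullet> vector [0, 0, 1]
                 = - a2 * norm R0 * R1"
        proof (intro allI impI)
          fix a1 a2 P0 G0 N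
          assume G0: "G0 = ?G a1 a2" and icp: "?icp P0 G0 N"
          have P0: "P0 = (1 / A) *\<^sub>R cross3 G0 R0" and orth: "G0 \<bullet> R0 = 0"
            and N: "N = (C - A) / A * Omega A C G0 $ 3"
            using icp unfolding iff[OF R0D grad] by blast+
          have n0: "norm R0 \<noteq> 0" using R0D assms(5) by auto
          have G3: "G0 $ 3 = - (a2 * (A / norm R0) * R1)"
            unfolding G0 R0 by (rule precession_G_nth)
          have third_nth: "x \<bullet> vector [0, 0, 1] = x $ 3" for x :: "real^3"
            by (simp add: inner_vec_def sum_3)
          have "Omega_tilde A C G0 N = (1 / A) *\<^sub>R G0"
            unfolding Omega_tilde_def N using AC
            by (simp add: Omega_eq vec_eq_iff forall_3 field_simps)
          then have "cross3 R0 (cross3 (Omega_tilde A C G0 N) R0) = ((norm R0)\<^sup>2 / A) *\<^sub>R G0"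
            using orth
            by (simp add: cross_mult_left cross_mult_right Lagrange power2_norm_eq_inner
                inner_commute)
          then have "cross3 R0 (cross3 (Omega_tilde A C G0 N) R0) $ 3 = - a2 * norm R0 * R1"
            using n0 AC by (simp add: G3 power2_eq_square)
          moreover have "P0 $ 3 = - a1 * R1"
            unfolding P0 G0 using AC by (simp add: cross3_def precession_G_nth R0)
          ultimately show "R0 \<bullet> vector [0, 0, 1] = R3 \<and>
               P0 \<bullet> vector [0, 0, 1] = - a1 * R1 \<and>
               cross3 R0 (cross3 (Omega_tilde A C G0 N) R0) \<bullet> vector [0, 0, 1]
                 = - a2 * norm R0 * R1"
            unfolding third_nth by (simp add: R0)
        qed
      qed
    qed
  qed
qed

end
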